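(* Let $n\in\mathbb{N}$, let $\nu\in\mathbb{C}$ with $\nu\notin-\mathbb{N}=\{-1,-2,\dots\}$, and let $\ell\in\{0,1\}$. Let $H_n^{(\ell)}(\nu)$ be the $n\times n$ Hankel matrix whose $(i,j)$-th entry, $1\le i,j\le n$, is $\sigma_{2(i+j+\ell-1)}(\nu)$. Then $$\det H_{n}^{(\ell)}(\nu)=2^{-2n(n+\ell)}\prod_{k=1}^{2n+\ell-1}\left(\nu+k\right)^{k-2n-\ell}.$$
   Context: $\mathbb{N}$ denotes the set of positive integers. $J_\nu$ is the Bessel function of the first kind. For $\nu\notin-\mathbb{N}$, the function $\rho\mapsto\rho^{-\nu}J_{\nu}(\rho)$ is (extends to) an even entire function that does not vanish at the origin. Let $j_{\nu,1},j_{\nu,2},\dots$ denote those of its zeros for which either $\operatorname{Re} j_{\nu,m}>0$, or $\operatorname{Re} j_{\nu,m}=0$ and $\operatorname{Im} j_{\nu,m}>0$ (the remaining zeros are $-j_{\nu,m}$, $m\in\mathbb{N}$). For $k\in\mathbb{N}$, the Rayleigh function of order $2k$ is $$\sigma_{2k}(\nu):=\sum_{m=1}^{\infty}\frac{1}{j_{\nu,m}^{2k}}.$$ *)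

theory Defs
  imports
    "HOL-Complex_Analysis.Complex_Analysis"
    "Jordan_Normal_Form.Determinant"
begin

text \<open>
  The usual power series of the Bessel function of the first kind, with the principal branch of
  the power. The reciprocal Gamma function is entire, so no parameter has to be excluded.
\<close>

definition Bessel_J :: "complex \<Rightarrow> complex \<Rightarrow> complex" where
  "Bessel_J \<nu> z =
     (z / 2) powr \<nu> * (\<Sum>m. (- 1) ^ m * rGamma (\<nu> + of_nat m + 1) / fact m * (z / 2) ^ (2 * m))"

text \<open>
  Away from the origin, the branch cut of \<open>z powr (- \<nu>)\<close> cancels against that of \<open>Bessel_J \<nu> z\<close>:
\<close>

lemma Bessel_J_normalized:
  assumes "z \<noteq> 0"
  shows "z powr (- \<nu>) * Bessel_J \<nu> z =
     2 powr (- \<nu>) * (\<Sum>m. (- 1) ^ m * rGamma (\<nu> + of_nat m + 1) / fact m * (z / 2) ^ (2 * m))"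
proof -
  have "Ln z = Ln (z / 2) + Ln 2"
    using Ln_divide_of_real[of 2 z] Ln_of_real[of 2] assms by simp
  then have "z powr (- \<nu>) * (z / 2) powr \<nu> = 2 powr (- \<nu>)"
    using assms by (simp add: powr_def exp_add[symmetric] algebra_simps)
  then show ?thesis
    by (simp add: Bessel_J_def mult.assoc[symmetric])
qed

text \<open>
  The zeros \<open>j\<^bsub>\<nu>,m\<^esub>\<close>, as a set. The half-plane condition excludes the origin, so the value there
  is irrelevant. Nonzero zeros of a Bessel function are simple, so nothing is lost by not recording
  multiplicities.
\<close>

definition Bessel_zeros :: "complex \<Rightarrow> complex set" where
  "Bessel_zeros \<nu> =
     {z. z powr (- \<nu>) * Bessel_J \<nu> z = 0 \<and> (Re z > 0 \<or> Re z = 0 \<and> Im z > 0)}"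

text \<open>
  \<open>Rayleigh k \<nu>\<close> is the Rayleigh function \<open>\<sigma>\<^bsub>2k\<^esub>(\<nu>)\<close> of order \<open>2k\<close>, for \<open>k \<ge> 1\<close>. The series converges
  absolutely, so the sum does not depend on an enumeration of the zeros.
\<close>

definition Rayleigh :: "nat \<Rightarrow> complex \<Rightarrow> complex" where
  "Rayleigh k \<nu> = (\<Sum>\<^sub>\<infinity>j\<in>Bessel_zeros \<nu>. 1 / j ^ (2 * k))"

text \<open>Matrix indices start at \<open>0\<close> here, hence the shift by \<open>Suc\<close>.\<close>

definition Rayleigh_Hankel :: "nat \<Rightarrow> nat \<Rightarrow> complex \<Rightarrow> complex mat" where
  "Rayleigh_Hankel l n \<nu> = Matrix.mat n n (\<lambda>(i, j). Rayleigh (Suc i + Suc j + l - 1) \<nu>)"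

end

theory Submission
  imports Defs "HOL-Real_Asymp.Real_Asymp"
begin

text \<open>
  Put \<open>E\<^sub>\<nu>(z\<^sup>2)\<close> for \<open>z powr (- \<nu>) * Bessel_J \<nu> z\<close>, normalized at the origin; \<open>E\<^sub>\<nu>\<close> is an entire function of
  order at most \<open>1/2\<close> with simple zeros. Dividing out its zeros in a disc of radius \<open>R\<close> leaves an
  exponential \<open>exp h\<close> there, and the Borel-Caratheodory inequality makes the Taylor coefficients of
  \<open>h'\<close> vanish as \<open>R\<close> grows. Hence the Rayleigh functions are the Taylor coefficients of
  \<open>S\<^sub>\<nu> = - E\<^sub>\<nu>' / E\<^sub>\<nu>\<close>. The three-term recurrence for Bessel functions becomes
  \<open>4 (\<nu> + 1) S\<^sub>\<nu>(w) = 1 + 4 w S\<^sub>\<nu>(w) S\<^bsub>\<nu>+1\<^esub>(w)\<close>, one step of a Stieltjes continued fraction, and such a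
  step relates the Hankel matrices of \<open>S\<^sub>\<nu>\<close> and \<open>S\<^bsub>\<nu>+1\<^esub>\<close> by a congruence with a triangular Toeplitz matrix.
\<close>

subsection \<open>Hankel determinants and one continued fraction step\<close>

definition hankel :: "(nat \<Rightarrow> 'a) \<Rightarrow> nat \<Rightarrow> nat \<Rightarrow> 'a :: comm_ring_1 mat" where
  "hankel s l n = Matrix.mat n n (\<lambda>(i, j). s (i + j + l))"

lemma hankel_dims [simp]: "dim_row (hankel s l n) = n" "dim_col (hankel s l n) = n"
  "hankel s l n \<in> carrier_mat n n"
  by (simp_all add: hankel_def)

text \<open>The term \<open>p = 0\<close> of the outer sum collapses by \<open>rec\<close> to
  \<open>u (Suc i) * u (Suc j)\<close>. The right side is symmetric in \<open>i\<close> and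
  \<open>j\<close>, which drives the induction of \<open>convolution_odd\<close>, and it exposes the
  shifted sequence that the even case needs.\<close>

lemma convolution_exchange:
  fixes u v :: "nat \<Rightarrow> 'a :: comm_ring_1"
  assumes rec: "\<And>m. u (Suc m) = d * (\<Sum>p\<le>m. u (m - p) * v p)"
  shows "d * (\<Sum>p\<le>Suc i. \<Sum>q\<le>j. u (Suc i - p) * u (j - q) * v (p + q)) =
    u (Suc i) * u (Suc j) + d * (\<Sum>p\<le>i. \<Sum>q\<le>j. u (i - p) * u (j - q) * v (Suc (p + q)))"
proof -
  have "(\<Sum>p\<le>Suc i. \<Sum>q\<le>j. u (Suc i - p) * u (j - q) * v (p + q)) =
      u (Suc i) * (\<Sum>q\<le>j. u (j - q) * v q) +
      (\<Sum>p\<le>i. \<Sum>q\<le>j. u (i - p) * u (j - q) * v (Suc (p + q)))"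
    by (subst sum.atMost_Suc_shift) (simp add: sum_distrib_left mult.assoc)
  then show ?thesis
    by (simp add: rec[of j] algebra_simps)
qed

text \<open>The recurrence says \<open>U(x) = c + d x U(x) V(x)\<close> for the generating functions, and the double sum
  is the coefficient of \<open>x\<^sup>i y\<^sup>j\<close> in
  \<open>c (U(x) - U(y)) / (x - y) = d U(x) U(y) (x V(x) - y V(y)) / (x - y)\<close>.\<close>

lemma convolution_odd:
  fixes u v :: "nat \<Rightarrow> 'a :: comm_ring_1"
  assumes rec: "\<And>m. u (Suc m) = d * (\<Sum>p\<le>m. u (m - p) * v p)" and "u 0 = c"
  shows "d * (\<Sum>p\<le>i. \<Sum>q\<le>j. u (i - p) * u (j - q) * v (p + q)) = c * u (Suc (i + j))"
proof (induction i arbitrary: j)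
  case 0
  have "(\<Sum>q\<le>j. u 0 * u (j - q) * v q) = c * (\<Sum>q\<le>j. u (j - q) * v q)"
    by (simp add: sum_distrib_left mult.assoc assms(2))
  then show ?case
    by (simp add: rec[of j] algebra_simps)
next
  case (Suc i)
  have sym: "(\<Sum>p\<le>i. \<Sum>q\<le>j. u (i - p) * u (j - q) * v (Suc (p + q))) =
      (\<Sum>q\<le>j. \<Sum>p\<le>i. u (j - q) * u (i - p) * v (Suc (q + p)))"
    by (subst sum.swap) (simp add: ac_simps)
  \<comment> \<open>By the symmetry in \<open>convolution_exchange\<close>, one unit moves from the
    first index to the second; the induction hypothesis then applies with \<open>Suc j\<close> in
    place of \<open>j\<close>.\<close>
  have "d * (\<Sum>p\<le>Suc i. \<Sum>q\<le>j. u (Suc i - p) * u (j - q) * v (p + q)) =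
      d * (\<Sum>p\<le>Suc j. \<Sum>q\<le>i. u (Suc j - p) * u (i - q) * v (p + q))"
    unfolding convolution_exchange[of u d v, OF rec] sym by (simp add: mult.commute)
  also have "\<dots> = d * (\<Sum>q\<le>i. \<Sum>p\<le>Suc j. u (i - q) * u (Suc j - p) * v (q + p))"
    by (subst sum.swap) (simp add: ac_simps)
  also have "\<dots> = c * u (Suc (i + Suc j))"
    by (rule Suc.IH)
  finally show ?case by simp
qed

text \<open>Matrix of multiplication by the generating function of \<open>u\<close> on power series
  truncated after \<open>n\<close> terms.\<close>

definition toeplitz :: "(nat \<Rightarrow> 'a) \<Rightarrow> nat \<Rightarrow> 'a :: comm_ring_1 mat" where
  "toeplitz u n = Matrix.mat n n (\<lambda>(i, j). if j \<le> i then u (i - j) else 0)"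

lemma toeplitz_carrier [simp]: "toeplitz u n \<in> carrier_mat n n"
  by (simp add: toeplitz_def)

lemma det_toeplitz: "Determinant.det (toeplitz u n) = u 0 ^ n"
proof -
  have "diag_mat (toeplitz u n) = replicate n (u 0)"
    by (auto simp: diag_mat_def toeplitz_def intro!: nth_equalityI)
  then show ?thesis
    by (subst det_lower_triangular[of n]) (auto simp: toeplitz_def)
qed

text \<open>Congruence multiplies the generating function of \<open>K\<close> in two variables by
  \<open>U(x) U(y)\<close>; triangularity cuts the sums at \<open>i\<close> and \<open>j\<close>,
  which gives the double sums of the convolution lemmas.\<close>

lemma toeplitz_congruence_index:
  assumes "K \<in> carrier_mat n n" "i < n" "j < n"
  shows "(toeplitz u n * K * transpose_mat (toeplitz u n)) $$ (i, j) =
    (\<Sum>p\<le>i. \<Sum>q\<le>j. u (i - p) * u (j - q) * K $$ (p, q))"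
proof -
  have cut: "(\<Sum>p<n. if p \<le> k then f p else 0) = (\<Sum>p\<le>k. f p)" if "k < n" for k and f :: "nat \<Rightarrow> 'a"
    using that by (intro sum.mono_neutral_cong_right) auto
  have K: "dim_row K = n" "dim_col K = n"
    using assms(1) by auto
  have "(toeplitz u n * K * transpose_mat (toeplitz u n)) $$ (i, j) =
      (\<Sum>q<n. (\<Sum>p<n. (if p \<le> i then u (i - p) else 0) * K $$ (p, q)) *
        (if q \<le> j then u (j - q) else 0))"
    using assms(2,3) K by (simp add: toeplitz_def scalar_prod_def atLeast0LessThan)
  also have "\<dots> = (\<Sum>q<n. if q \<le> j then \<Sum>p<n. if p \<le> i then u (i - p) * u (j - q) * K $$ (p, q) else 0 else 0)"
    by (intro sum.cong refl) (auto simp: sum_distrib_right sum_distrib_left mult_ac intro!: sum.cong)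
  also have "\<dots> = (\<Sum>q\<le>j. \<Sum>p\<le>i. u (i - p) * u (j - q) * K $$ (p, q))"
    by (simp add: cut assms)
  finally show ?thesis
    by (subst sum.swap) 
qed

lemma det_toeplitz_congruence:
  assumes "K \<in> carrier_mat n n"
  shows "Determinant.det (toeplitz u n * K * transpose_mat (toeplitz u n)) =
    u 0 ^ (2 * n) * Determinant.det K"
  using assms det_transpose[OF toeplitz_carrier[of u n]]
  by (simp add: det_mult[where n = n] det_toeplitz mult_2 power_add mult_carrier_mat[where n = n])

text \<open>Entrywise, \<open>convolution_odd\<close> is a congruence by a Toeplitz matrix of
  determinant \<open>c ^ n\<close>. Of the resulting \<open>c ^ (2 * n)\<close>, half cancels
  against the scaling of the left side by \<open>c\<close>.\<close>

lemma det_hankel_odd: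
  fixes u v :: "nat \<Rightarrow> 'a :: field"
  assumes rec: "\<And>m. u (Suc m) = d * (\<Sum>p\<le>m. u (m - p) * v p)" and c: "u 0 = c" "c \<noteq> 0"
  shows "Determinant.det (hankel u 1 n) = (c * d) ^ n * Determinant.det (hankel v 0 n)"
proof -
  have "c \<cdot>\<^sub>m hankel u 1 n = toeplitz u n * (d \<cdot>\<^sub>m hankel v 0 n) * transpose_mat (toeplitz u n)" (is "_ = ?R")
  proof (rule eq_matI)
    fix i j assume "i < dim_row ?R" "j < dim_col ?R"
    then have ij: "i < n" "j < n"
      by (auto simp: toeplitz_def)
    have "?R $$ (i, j) = (\<Sum>p\<le>i. \<Sum>q\<le>j. u (i - p) * u (j - q) * (d * v (p + q)))"
      using ij by (subst toeplitz_congruence_index) (auto simp: hankel_def)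
    also have "\<dots> = d * (\<Sum>p\<le>i. \<Sum>q\<le>j. u (i - p) * u (j - q) * v (p + q))"
      by (simp add: sum_distrib_left ac_simps)
    finally show "(c \<cdot>\<^sub>m hankel u 1 n) $$ (i, j) = ?R $$ (i, j)"
      using ij convolution_odd[of u d v, OF rec c(1)] by (simp add: hankel_def)
  qed (auto simp: toeplitz_def)
  from arg_cong[OF this, of Determinant.det]
  have "c ^ n * Determinant.det (hankel u 1 n) = c ^ (2 * n) * (d ^ n * Determinant.det (hankel v 0 n))"
    by (simp add: det_toeplitz_congruence c)
  then show ?thesis
    using c(2) by (simp add: mult_2 power_add power_mult_distrib)
qed

text \<open>The term \<open>u i * u j\<close> of \<open>convolution_exchange\<close> lies outside
  the double sum over \<open>v\<close>. An extra corner entry \<open>1\<close> in the middle matrix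
  produces it, and so the size drops by one.\<close>

lemma det_hankel_even:
  fixes u v :: "nat \<Rightarrow> 'a :: field"
  assumes rec: "\<And>m. u (Suc m) = d * (\<Sum>p\<le>m. u (m - p) * v p)" and c: "u 0 = c" "c \<noteq> 0"
  shows "Determinant.det (hankel u 0 (Suc n)) = c ^ Suc n * d ^ n * Determinant.det (hankel v 1 n)"
proof -
  define K where "K = four_block_mat (1\<^sub>m 1) (0\<^sub>m 1 n) (0\<^sub>m n 1) (d \<cdot>\<^sub>m hankel v 1 n)"
  have K: "K \<in> carrier_mat (Suc n) (Suc n)"
    unfolding K_def using four_block_carrier_mat[of "1\<^sub>m 1" 1 1 "d \<cdot>\<^sub>m hankel v 1 n" n n] by simp
  \<comment> \<open>The truncated subtractions \<open>p - 1\<close> and \<open>q - 1\<close> are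
    reached for positive indices only.\<close>
  have Knth: "K $$ (p, q) = (if p = 0 \<and> q = 0 then 1 else if p = 0 \<or> q = 0 then 0
      else d * v (Suc ((p - 1) + (q - 1))))" if "p \<le> n" "q \<le> n" for p q
    using that by (cases p; cases q) (auto simp: K_def hankel_def)
  have "c \<cdot>\<^sub>m hankel u 0 (Suc n) = toeplitz u (Suc n) * K * transpose_mat (toeplitz u (Suc n))" (is "_ = ?R")
  proof (rule eq_matI)
    fix i j assume "i < dim_row ?R" "j < dim_col ?R"
    then have ij: "i < Suc n" "j < Suc n"
      by (auto simp: toeplitz_def)
    have "?R $$ (i, j) = (\<Sum>p\<le>i. \<Sum>q\<le>j. u (i - p) * u (j - q) * K $$ (p, q))"
      by (rule toeplitz_congruence_index[OF K ij])
    also have "\<dots> = c * u (i + j)"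
    \<comment> \<open>In row or column 0 only the corner \<open>p = q = 0\<close> contributes, and
      one of the two factors is \<open>u 0 = c\<close>.\<close>
    proof (cases i)
      case 0
      then show ?thesis
        using ij by (subst sum.remove[of _ 0]) (auto simp: Knth c)
    next
      case i: (Suc i')
      show ?thesis
      proof (cases j)
        case 0
        then show ?thesis
          using ij i by (subst sum.remove[of _ 0]) (auto simp: Knth c)
      next
        case j: (Suc j')
        have "(\<Sum>p\<le>i. \<Sum>q\<le>j. u (i - p) * u (j - q) * K $$ (p, q)) =
            u i * u j + (\<Sum>p\<le>i'. \<Sum>q\<le>j'. u (i' - p) * u (j' - q) * (d * v (Suc (p + q))))"
          using ij unfolding i j
          by (simp add: sum.atMost_Suc_shift Knth del: sum.atMost_Suc)
        also have "(\<Sum>p\<le>i'. \<Sum>q\<le>j'. u (i' - p) * u (j' - q) * (d * v (Suc (p + q)))) =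
            d * (\<Sum>p\<le>i'. \<Sum>q\<le>j'. u (i' - p) * u (j' - q) * v (Suc (p + q)))"
          by (simp add: sum_distrib_left ac_simps)
        also have "u i * u j + \<dots> = c * u (i + j)"
          using convolution_exchange[of u d v i' j', OF rec] convolution_odd[of u d v c i j', OF rec c(1)]
          by (simp add: i j)
        finally show ?thesis .
      qed
    qed
    finally show "(c \<cdot>\<^sub>m hankel u 0 (Suc n)) $$ (i, j) = ?R $$ (i, j)"
      using ij by (simp add: hankel_def)
  qed (auto simp: toeplitz_def)
  from arg_cong[OF this, of Determinant.det]
  have "c ^ Suc n * Determinant.det (hankel u 0 (Suc n)) = c ^ (2 * Suc n) * Determinant.det K"
    using K by (simp add: det_toeplitz_congruence c)
  moreover have "Determinant.det K = d ^ n * Determinant.det (hankel v 1 n)"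
    unfolding K_def by (subst det_four_block_mat_lower_left_zero[of _ 1 _ n]) auto
  ultimately have "c ^ Suc n * Determinant.det (hankel u 0 (Suc n)) =
      c ^ Suc n * (c ^ Suc n * d ^ n * Determinant.det (hankel v 1 n))"
    unfolding mult_2 power_add by (simp only: mult.assoc)
  then show ?thesis
    using c(2) by (simp del: power_Suc)
qed

subsection \<open>Power sums of the zeros of an entire function\<close>

text \<open>Zeros are split off one at a time: the points are distinct, so the remaining factor
  still vanishes at the next one. The linear factors equal 1 at the origin, hence
  \<open>g 0 = f 0\<close>.\<close>

lemma holomorphic_factor_zeros:
  fixes f :: "complex \<Rightarrow> complex"
  assumes "finite A" "f holomorphic_on UNIV" "\<And>a. a \<in> A \<Longrightarrow> f a = 0" "0 \<notin> A"
  shows "\<exists>g. g holomorphic_on UNIV \<and> (\<forall>z. f z = (\<Prod>a\<in>A. 1 - z / a) * g z)"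
  using assms
proof (induction A rule: finite_induct)
  case empty
  then show ?case by auto
next
  case (insert a A)
  then obtain g where g: "g holomorphic_on UNIV" "\<And>z. f z = (\<Prod>a\<in>A. 1 - z / a) * g z"
    by auto
  have a: "a \<noteq> 0" using insert.prems by auto
  have "(\<Prod>b\<in>A. 1 - a / b) \<noteq> 0"
    using insert by (auto simp: field_simps)
  moreover have "f a = 0" using insert.prems by simp
  ultimately have ga: "g a = 0" using g(2)[of a] by simp
  \<comment> \<open>This is \<open>g z / (1 - z / a)\<close>, with the derivative filling the
    removable singularity at \<open>a\<close>.\<close>
  define k where "k = (\<lambda>z. - a * (if z = a then deriv g a else (g z - g a) / (z - a)))"
  have "k holomorphic_on UNIV"
    unfolding k_def by (intro holomorphic_intros pole_lemma g) auto
  moreover have "g z = (1 - z / a) * k z" for z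
    using a ga by (cases "z = a") (auto simp: k_def field_simps)
  ultimately show ?case
    using insert g by (intro exI[of _ k]) (auto simp: mult_ac)
qed

text \<open>On the circle of radius \<open>(t + 1) * R\<close> every linear factor has modulus at
  least \<open>(t + 1) - 1 = t\<close>, and the maximum principle carries the bound inside. The case
  \<open>t = 2\<close> counts zeros; the case \<open>t = 1\<close> bounds the quotient independently
  of \<open>card A\<close>.\<close>

lemma norm_quotient_le_of_zeros:
  fixes f g :: "complex \<Rightarrow> complex"
  assumes "finite A" "A \<subseteq> cball 0 R" "0 \<notin> A" "0 < R" "0 < t"
    and g: "g holomorphic_on UNIV" "\<And>z. f z = (\<Prod>a\<in>A. 1 - z / a) * g z"
    and f: "\<And>z. norm z = (t + 1) * R \<Longrightarrow> norm (f z) \<le> M"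
    and z: "norm z \<le> (t + 1) * R"
  shows "norm (g z) \<le> M / t ^ card A"
proof (rule maximum_modulus_frontier[where f = g and S = "cball 0 ((t + 1) * R)"])
  show "g holomorphic_on interior (cball 0 ((t + 1) * R))"
    by (rule holomorphic_on_subset[OF g(1)]) simp
  show "continuous_on (closure (cball 0 ((t + 1) * R))) g"
    by (rule continuous_on_subset[OF holomorphic_on_imp_continuous_on[OF g(1)]]) simp
  fix w :: complex assume "w \<in> frontier (cball 0 ((t + 1) * R))"
  then have w: "norm w = (t + 1) * R"
    using assms(4,5) by (simp add: frontier_cball)
  have "t \<le> norm (1 - w / a)" if "a \<in> A" for a
  proof -
    have "norm a \<le> R" "a \<noteq> 0" using that assms(2,3) by auto
    then have "(t + 1) * norm a \<le> norm w"
      unfolding w using assms(4,5) by (intro mult_left_mono) auto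
    then have "norm w / norm a \<ge> t + 1"
      using \<open>a \<noteq> 0\<close> by (simp add: field_simps)
    moreover have "norm (1 - w / a) \<ge> norm (w / a) - norm (1::complex)"
      by (metis norm_minus_commute norm_triangle_ineq2)
    ultimately show ?thesis
      by (simp add: norm_divide)
  qed
  then have "t ^ card A \<le> (\<Prod>a\<in>A. norm (1 - w / a))"
    using prod_mono[of A "\<lambda>_. t" "\<lambda>a. norm (1 - w / a)"] \<open>0 < t\<close> by simp
  then have "t ^ card A * norm (g w) \<le> norm (f w)"
    by (simp add: g(2) norm_mult prod_norm mult_right_mono)
  also have "\<dots> \<le> M" by (rule f[OF w])
  finally show "norm (g w) \<le> M / t ^ card A"
    using \<open>0 < t\<close> by (simp add: field_simps)
qed (use z in auto)

section \<open>The Borel-Caratheodory inequality\<close>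

text \<open>The Schwarz lemma applies to \<open>h / (4 * B - h)\<close>: since
  \<open>Re h \<le> B < 2 * B\<close>, the values of \<open>h\<close> are closer to 0 than to
  \<open>4 * B\<close>.\<close>

lemma norm_le_of_Re_le:
  fixes h :: "complex \<Rightarrow> complex"
  assumes h: "h holomorphic_on ball 0 R" "h 0 = 0" and "0 < R" "0 < B"
    and Re: "\<And>z. norm z < R \<Longrightarrow> Re (h z) \<le> B" and z: "norm z \<le> R / 2"
  shows "norm (h z) \<le> 4 * B"
proof -
  \<comment> \<open>The constant \<open>4 * B\<close> in place of the sharper \<open>2 * B\<close>
    makes \<open>norm (\<phi> w) < 1\<close> strict.\<close>
  define \<phi> where "\<phi> = (\<lambda>w. h (of_real R * w) / (of_real (4 * B) - h (of_real R * w)))"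
  have inball: "norm (of_real R * w) < R" if "norm w < 1" for w :: complex
    using that \<open>0 < R\<close> by (simp add: norm_mult)
  have nz: "of_real (4 * B) - h w \<noteq> 0" if "norm w < R" for w
    using Re[OF that] \<open>0 < B\<close> by (auto simp: complex_eq_iff)
  have "\<phi> holomorphic_on ball 0 1"
    unfolding \<phi>_def using inball nz
    by (intro holomorphic_intros holomorphic_on_compose_gen[OF _ h(1), unfolded o_def]) auto
  moreover have "\<phi> 0 = 0" by (simp add: \<phi>_def h)
  moreover have "norm (\<phi> w) < 1" if w: "norm w < 1" for w
  proof -
    let ?u = "h (of_real R * w)"
    have "(norm ?u)\<^sup>2 < (norm (of_real (4 * B) - ?u))\<^sup>2"
    proof -
      have "0 < 8 * B * (2 * B - Re ?u)"
        using Re[OF inball[OF w]] \<open>0 < B\<close> by simp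
      then show ?thesis
        unfolding cmod_power2 by (simp add: power2_eq_square algebra_simps)
    qed
    then have "norm ?u < norm (of_real (4 * B) - ?u)"
      by (rule power2_less_imp_less) simp
    then show ?thesis
      using nz[OF inball[OF w]] by (simp add: \<phi>_def norm_divide)
  qed
  ultimately have "norm (\<phi> (z / of_real R)) \<le> norm (z / of_real R)"
    using z \<open>0 < R\<close> by (intro Schwarz_Lemma(1)) (auto simp: norm_divide)
  also have "\<dots> \<le> 1 / 2"
    using z \<open>0 < R\<close> by (simp add: norm_divide field_simps)
  finally have le: "norm (h z) / norm (of_real (4 * B) - h z) \<le> 1 / 2"
    using \<open>0 < R\<close> by (simp add: \<phi>_def norm_divide)
  have "norm z < R" using z \<open>0 < R\<close> by linarith
  then have "2 * norm (h z) \<le> norm (of_real (4 * B) - h z)"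
    using le nz[of z] by (simp add: field_simps)
  also have "\<dots> \<le> norm (of_real (4 * B) :: complex) + norm (h z)"
    by (rule norm_triangle_ineq4)
  also have "norm (of_real (4 * B) :: complex) = 4 * B"
    using \<open>0 < B\<close> by (simp only: norm_of_real)
  finally show ?thesis by simp
qed

text \<open>Cauchy's inequality on the circle of radius \<open>R / 2\<close>, where
  \<open>norm_le_of_Re_le\<close> bounds \<open>h\<close>.\<close>

lemma norm_fps_nth_le_of_Re_le:
  fixes h :: "complex \<Rightarrow> complex"
  assumes h: "h holomorphic_on ball 0 R" "h 0 = 0" and "0 < R" "0 < B"
    and Re: "\<And>z. norm z < R \<Longrightarrow> Re (h z) \<le> B" and H: "h has_fps_expansion H"
  shows "norm (fps_nth H n) \<le> 4 * B / (R / 2) ^ n"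
proof -
  have "norm ((deriv ^^ n) h 0) \<le> fact n * (4 * B) / (R / 2) ^ n"
  proof (rule Cauchy_inequality)
    show "h holomorphic_on ball 0 (R / 2)" "continuous_on (cball 0 (R / 2)) h"
      using \<open>0 < R\<close> by (auto intro!: holomorphic_on_imp_continuous_on holomorphic_on_subset[OF h(1)])
    show "norm (h x) \<le> 4 * B" if "norm (0 - x) = R / 2" for x
      using norm_le_of_Re_le[OF h \<open>0 < R\<close> \<open>0 < B\<close> Re] that by simp
  qed (use \<open>0 < R\<close> in auto)
  then show ?thesis
    by (simp add: fps_nth_fps_expansion[OF H] norm_divide field_simps)
qed

section \<open>Logarithmic derivatives of formal power series\<close>

lemma fps_logderiv_mult:
  fixes F G :: "'a :: field fps"
  assumes "fps_nth F 0 \<noteq> 0" "fps_nth G 0 \<noteq> 0"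
  shows "fps_deriv (F * G) * inverse (F * G) = fps_deriv F * inverse F + fps_deriv G * inverse G"
proof -
  have "F * inverse F = 1" "G * inverse G = 1"
    using assms by (simp_all add: inverse_mult_eq_1')
  have "fps_deriv (F * G) * inverse (F * G) =
      fps_deriv F * inverse F * (G * inverse G) + fps_deriv G * inverse G * (F * inverse F)"
    by (simp add: fps_inverse_mult algebra_simps)
  with \<open>F * inverse F = 1\<close> \<open>G * inverse G = 1\<close> show ?thesis by simp
qed

lemma fps_logderiv_prod:
  fixes F :: "'b \<Rightarrow> 'a :: field fps"
  assumes "\<And>a. a \<in> A \<Longrightarrow> fps_nth (F a) 0 \<noteq> 0"
  shows "fps_deriv (\<Prod>a\<in>A. F a) * inverse (\<Prod>a\<in>A. F a) = (\<Sum>a\<in>A. fps_deriv (F a) * inverse (F a))"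
  using assms
proof (induction A rule: infinite_finite_induct)
  case (insert a A)
  have "fps_nth (\<Prod>a\<in>B. F a) 0 = (\<Prod>a\<in>B. fps_nth (F a) 0)" for B
    by (induction B rule: infinite_finite_induct) auto
  then have "fps_nth (\<Prod>a\<in>A. F a) 0 \<noteq> 0"
    using insert by auto
  with insert show ?case
    by (simp add: fps_logderiv_mult del: fps_deriv_mult)
qed auto

text \<open>Geometric series for \<open>- (1 / a) / (1 - X / a)\<close>.\<close>

lemma fps_logderiv_linear:
  fixes a :: "'a :: field"
  shows "fps_nth (fps_deriv (1 - fps_const (1 / a) * fps_X) * inverse (1 - fps_const (1 / a) * fps_X)) k =
    - 1 / a ^ Suc k"
proof -
  have "(1 - fps_const (1 / a) * fps_X) * Abs_fps (\<lambda>n. (1 / a) ^ n) = 1"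
    by (rule fps_ext) (auto simp: left_diff_distrib mult.assoc fps_mult_left_const_nth
        fps_X_mult_nth power_eq_if)
  then have "inverse (1 - fps_const (1 / a) * fps_X) = Abs_fps (\<lambda>n. (1 / a) ^ n)"
    by (metis fps_inverse_unique)
  moreover have "fps_deriv (1 - fps_const (1 / a) * fps_X) = fps_const (- (1 / a))"
    by (simp flip: fps_const_neg)
  ultimately show ?thesis
    by (simp add: power_one_over)
qed

section \<open>Counting zeros and summing their inverse powers\<close>

text \<open>Discs of radius \<open>r * 4 ^ k\<close> contain at most
  \<open>K * sqrt r * 2 ^ k\<close> points, and a point first met in such a disc contributes at most
  \<open>4 / (r * 4 ^ k)\<close>. The products form a geometric series of ratio
  \<open>1 / 2\<close>.\<close>

lemma summable_inverse_of_sqrt_count: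
  fixes Z :: "'a :: real_normed_vector set"
  assumes "0 < r" and r: "\<And>z. z \<in> Z \<Longrightarrow> r \<le> norm z"
    and count: "\<And>A R. finite A \<Longrightarrow> A \<subseteq> Z \<Longrightarrow> 0 < R \<Longrightarrow> A \<subseteq> cball 0 R \<Longrightarrow> real (card A) \<le> K * sqrt R"
  shows "(\<lambda>z. 1 / norm z) summable_on Z"
proof (rule nonneg_bdd_above_summable_on)
  show "bdd_above (sum (\<lambda>z. 1 / norm z) ` {F. F \<subseteq> Z \<and> finite F})"
  proof (rule bdd_aboveI2)
    fix F assume "F \<in> {F. F \<subseteq> Z \<and> finite F}"
    then have F: "F \<subseteq> Z" "finite F" by auto
    have "\<exists>k. norm z \<le> r * 4 ^ k \<and> 1 / norm z \<le> 4 / (r * 4 ^ k)" if "z \<in> Z" for z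
    proof -
      obtain N where "norm z / r < 4 ^ N"
        using real_arch_pow[of 4 "norm z / r"] by auto
      then have "norm z \<le> r * 4 ^ N"
        using \<open>0 < r\<close> by (simp add: field_simps)
      then have least: "norm z \<le> r * 4 ^ (LEAST k. norm z \<le> r * 4 ^ k)"
        by (rule LeastI)
      \<comment> \<open>The first disc containing \<open>z\<close>. Minimality bounds
        \<open>norm z\<close> from below, except for \<open>k = 0\<close>, where the hypothesis on
        \<open>r\<close> does.\<close>
      define k where "k = (LEAST k. norm z \<le> r * 4 ^ k)"
      have "r * 4 ^ k \<le> 4 * norm z"
      proof (cases k)
        case 0
        then show ?thesis using r[OF that] \<open>0 < r\<close> by simp
      next
        case (Suc m)
        then have "\<not> norm z \<le> r * 4 ^ m"
          unfolding k_def using not_less_Least[of m "\<lambda>k. norm z \<le> r * 4 ^ k"] by simp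
        then show ?thesis using Suc by simp
      qed
      moreover have "0 < norm z" using r[OF that] \<open>0 < r\<close> by linarith
      ultimately show ?thesis
        using least \<open>0 < r\<close> by (intro exI[of _ k]) (auto simp: k_def field_simps)
    qed
    then obtain \<kappa> where \<kappa>: "\<And>z. z \<in> Z \<Longrightarrow> norm z \<le> r * 4 ^ \<kappa> z"
        "\<And>z. z \<in> Z \<Longrightarrow> 1 / norm z \<le> 4 / (r * 4 ^ \<kappa> z)"
      by metis
    define N where "N = Suc (\<Sum>z\<in>F. \<kappa> z)"
    have N: "\<kappa> z < N" if "z \<in> F" for z
      using member_le_sum[of z F \<kappa>] that F by (simp add: N_def)
    define c where "c = (\<lambda>k. real (card {z \<in> F. norm z \<le> r * 4 ^ k}))"
    have "0 \<le> K"
      using count[of "{}" 1] by simp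
    have c: "c k \<le> K * (sqrt r * 2 ^ k)" for k
    proof -
      have "sqrt (4 ^ k) = (2 :: real) ^ k"
        using real_sqrt_power[of 4 k] by simp
      then show ?thesis
        using count[of "{z \<in> F. norm z \<le> r * 4 ^ k}" "r * 4 ^ k"] F(2) \<open>0 < r\<close> subsetD[OF F(1)]
        by (simp add: c_def real_sqrt_mult subset_iff)
    qed
    \<comment> \<open>Each point is charged to all discs containing it, so that only cardinalities
      of discs occur. The final bound is free of \<open>N\<close> and \<open>F\<close>.\<close>
    have "(\<Sum>z\<in>F. 1 / norm z) \<le> (\<Sum>z\<in>F. \<Sum>k<N. if norm z \<le> r * 4 ^ k then 4 / (r * 4 ^ k) else 0)"
    proof (rule sum_mono)
      fix z assume z: "z \<in> F"
      have "1 / norm z \<le> (if norm z \<le> r * 4 ^ \<kappa> z then 4 / (r * 4 ^ \<kappa> z) else 0)"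
        using \<kappa>[of z] z F by auto
      also have "\<dots> \<le> (\<Sum>k<N. if norm z \<le> r * 4 ^ k then 4 / (r * 4 ^ k) else 0)"
        using N[OF z] \<open>0 < r\<close> by (intro member_le_sum) auto
      finally show "1 / norm z \<le> \<dots>" .
    qed
    also have "\<dots> = (\<Sum>k<N. \<Sum>z\<in>F. if norm z \<le> r * 4 ^ k then 4 / (r * 4 ^ k) else 0)"
      by (rule sum.swap)
    also have "\<dots> = (\<Sum>k<N. 4 / (r * 4 ^ k) * c k)"
      using F by (intro sum.cong refl) (simp add: sum.If_cases c_def Int_def)
    also have "\<dots> \<le> (\<Sum>k<N. 4 / (r * 4 ^ k) * (K * (sqrt r * 2 ^ k)))"
      using c \<open>0 < r\<close> by (intro sum_mono mult_left_mono) auto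
    also have "\<dots> = 4 * K * sqrt r / r * (\<Sum>k<N. (1 / 2) ^ k)"
      unfolding sum_distrib_left
    proof (intro sum.cong refl)
      fix k
      have "(4 :: real) ^ k = 2 ^ k * 2 ^ k"
        by (simp flip: power_mult_distrib)
      then show "4 / (r * 4 ^ k) * (K * (sqrt r * 2 ^ k)) = 4 * K * sqrt r / r * (1 / 2) ^ k"
        using \<open>0 < r\<close> by (simp add: field_simps power_one_over)
    qed
    also have "\<dots> \<le> 4 * K * sqrt r / r * 2"
      using \<open>0 \<le> K\<close> \<open>0 < r\<close> by (intro mult_left_mono) (auto simp: sum_gp_strict)
    finally show "(\<Sum>z\<in>F. 1 / norm z) \<le> 4 * K * sqrt r / r * 2" .
  qed
qed auto

text \<open>Entire functions of order at most \<open>1 / 2\<close>, normalized at the origin.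
  Simplicity makes sums over the zero set agree with sums counting multiplicity.\<close>

locale entire_sqrt_growth =
  fixes f :: "complex \<Rightarrow> complex" and C :: real
  assumes holo: "f holomorphic_on UNIV" and f0: "f 0 = 1" and C: "0 < C"
    and growth: "\<And>z. norm (f z) \<le> exp (C * sqrt (norm z))"
    and simple: "\<And>z. f z = 0 \<Longrightarrow> deriv f z \<noteq> 0"
begin

text \<open>A Jensen-type count: the quotient by the linear factors is 1 at the origin, yet at most
  \<open>exp (C * sqrt (3 * R)) / 2 ^ card A\<close> there.\<close>

lemma card_zeros_le:
  assumes "finite A" "A \<subseteq> {z. f z = 0}" "0 < R" "A \<subseteq> cball 0 R"
  shows "real (card A) \<le> C * sqrt 3 / ln 2 * sqrt R"
proof -
  have "0 \<notin> A" using assms(2) f0 by auto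
  have "f a = 0" if "a \<in> A" for a using that assms(2) by blast
  then obtain g where g: "g holomorphic_on UNIV" "\<And>z. f z = (\<Prod>a\<in>A. 1 - z / a) * g z"
    using holomorphic_factor_zeros[OF assms(1) holo _ \<open>0 \<notin> A\<close>] by blast
  have "norm (g 0) \<le> exp (C * sqrt (3 * R)) / 2 ^ card A"
  proof (rule norm_quotient_le_of_zeros[where f = f and g = g, OF assms(1,4) \<open>0 \<notin> A\<close> assms(3) zero_less_numeral g])
    show "norm (f w) \<le> exp (C * sqrt (3 * R))" if "norm w = (2 + 1) * R" for w
      using growth[of w] that by simp
  qed (use assms(3) in simp)
  moreover have "g 0 = 1" using g(2)[of 0] f0 by simp
  ultimately have "2 ^ card A \<le> exp (C * sqrt (3 * R))"
    by (simp add: field_simps)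
  then have "ln (2 ^ card A) \<le> C * sqrt (3 * R)"
    by (metis ln_exp ln_mono zero_less_numeral zero_less_power)
  then show ?thesis
    by (simp add: ln_realpow real_sqrt_mult field_simps)
qed

text \<open>The bound of \<open>card_zeros_le\<close> is uniform over all finite sets of zeros in
  the disc.\<close>

lemma finite_zeros_cball: "finite ({z. f z = 0} \<inter> cball 0 R)"
proof (cases "0 < R")
  case True
  show ?thesis
  proof (rule conjunct1[OF finite_if_finite_subsets_card_bdd])
    fix G assume "G \<subseteq> {z. f z = 0} \<inter> cball 0 R" "finite G"
    then have "real (card G) \<le> C * sqrt 3 / ln 2 * sqrt R"
      using True by (intro card_zeros_le) auto
    then show "card G \<le> nat \<lfloor>C * sqrt 3 / ln 2 * sqrt R\<rfloor>"
      by (simp add: le_nat_floor)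
  qed
next
  case False
  have "x = 0" if "x \<in> cball 0 R" for x :: complex
  proof -
    have "norm x \<le> R" using that by simp
    then show ?thesis using False norm_ge_zero[of x] by (metis less_eq_real_def norm_eq_zero order_trans not_less)
  qed
  then have "{z. f z = 0} \<inter> cball 0 R \<subseteq> {0}" by blast
  then show ?thesis by (rule finite_subset) simp
qed

text \<open>Continuity and \<open>f 0 = 1\<close> keep the zeros at distance at least
  \<open>r > 0\<close> from the origin. Hence the case \<open>k = 0\<close>, which follows from the
  zero count, dominates the others up to \<open>1 / r ^ k\<close>.\<close>

lemma abs_summable_zeros: "(\<lambda>z. norm (1 / z ^ Suc k)) summable_on {z. f z = 0}"
proof -
  have "isCont f 0"
    using holomorphic_on_imp_continuous_on[OF holo] by (simp add: continuous_on_eq_continuous_at)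
  then obtain r where r: "r > 0" "\<And>z. f z = 0 \<Longrightarrow> r \<le> norm z"
    using continuous_at_avoid[of 0 f 0] f0 by (force simp: not_less)
  have "(\<lambda>z. 1 / norm z) summable_on {z. f z = 0}"
    using r by (intro summable_inverse_of_sqrt_count[where r = r, OF _ _ card_zeros_le]) auto
  then have "(\<lambda>z. 1 / r ^ k * (1 / norm z)) summable_on {z. f z = 0}"
    by (rule summable_on_cmult_right)
  then show ?thesis
  proof (rule Infinite_Sum.abs_summable_on_comparison_test')
    fix z assume "z \<in> {z. f z = 0}"
    then have z: "r \<le> norm z" using r by auto
    then have "r ^ k \<le> norm z ^ k" using r(1) by (intro power_mono) auto
    then have "r ^ k * norm z \<le> norm z ^ Suc k"
      unfolding power_Suc2 by (rule mult_right_mono) simp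
    moreover have "0 < norm z" using z r(1) by linarith
    ultimately have "1 / norm z ^ Suc k \<le> 1 / (r ^ k * norm z)"
      using r(1) by (intro divide_left_mono) auto
    then show "norm (1 / z ^ Suc k) \<le> 1 / r ^ k * (1 / norm z)"
      by (simp add: norm_divide norm_power norm_mult)
  qed
qed

text \<open>With \<open>f = p * g\<close> and \<open>g = exp h\<close> on the disc, the linear
  factors of \<open>p\<close> contribute \<open>- 1 / a ^ Suc k\<close> each to the logarithmic
  derivative, and \<open>g\<close> contributes the coefficient of \<open>h'\<close>, which
  Borel-Caratheodory bounds.\<close>

lemma logderiv_minus_partial_sum_le:
  assumes F: "f has_fps_expansion F" and R: "0 < R"
  shows "norm (fps_nth (fps_deriv F * inverse F) k + (\<Sum>a\<in>{z. f z = 0} \<inter> cball 0 R. 1 / a ^ Suc k))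
    \<le> real (Suc k) * (4 * (C * sqrt (2 * R)) / (R / 2) ^ Suc k)"
proof -
  define A where "A = {z. f z = 0} \<inter> cball 0 R"
  have A: "finite A" "A \<subseteq> cball 0 R" "0 \<notin> A"
    using finite_zeros_cball[of R] f0 by (simp_all add: A_def)
  have "f a = 0" if "a \<in> A" for a using that by (simp add: A_def)
  then obtain g where g: "g holomorphic_on UNIV" "\<And>z. f z = (\<Prod>a\<in>A. 1 - z / a) * g z"
    using holomorphic_factor_zeros[OF A(1) holo _ A(3)] by blast
  have g0: "g 0 = 1" using g(2)[of 0] f0 by simp
  have norm_g: "norm (g z) \<le> exp (C * sqrt (2 * R))" if "norm z \<le> 2 * R" for z
  proof -
    have "norm (g z) \<le> exp (C * sqrt (2 * R)) / 1 ^ card A"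
    proof (rule norm_quotient_le_of_zeros[where f = f and g = g and A = A and R = R])
      show "norm (f w) \<le> exp (C * sqrt (2 * R))" if "norm w = (1 + 1) * R" for w
        using growth[of w] that by simp
    qed (use A R g that in simp_all)
    then show ?thesis by simp
  qed
  \<comment> \<open>A zero of \<open>g\<close> in the disc would also be a zero of the product
    \<open>p\<close>, hence a double zero of \<open>f\<close>.\<close>
  have g_nz: "g z \<noteq> 0" if "norm z < R" for z
  proof
    assume gz: "g z = 0"
    then have "z \<in> A" using that g(2)[of z] by (simp add: A_def)
    define p where "p = (\<lambda>z. \<Prod>a\<in>A. 1 - z / a)"
    have "(p has_field_derivative deriv p z) (at z)"
      unfolding p_def by (intro holomorphic_derivI[of _ UNIV] holomorphic_intros) (use A in auto)
    moreover have "(g has_field_derivative deriv g z) (at z)"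
      by (intro holomorphic_derivI[OF g(1)]) auto
    ultimately have "((\<lambda>z. p z * g z) has_field_derivative deriv p z * g z + deriv g z * p z) (at z)"
      by (rule DERIV_mult)
    moreover have "p z = 0"
      using \<open>z \<in> A\<close> A by (auto simp: p_def intro!: prod_zero bexI[of _ z])
    moreover have "f = (\<lambda>z. p z * g z)" using g(2) by (auto simp: p_def)
    ultimately have "deriv f z = 0" using gz by (simp add: DERIV_imp_deriv)
    then show False using simple[of z] \<open>z \<in> A\<close> by (simp add: A_def)
  qed
  obtain h' where h': "h' holomorphic_on ball 0 R" "\<And>z. z \<in> ball 0 R \<Longrightarrow> g z = exp (h' z)"
  proof (rule contractible_imp_holomorphic_log[of g "ball 0 R"])
    show "g holomorphic_on ball 0 R" using g(1) holomorphic_on_subset by blast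
    show "contractible (ball (0::complex) R)" by (simp add: convex_imp_contractible)
  qed (use g_nz in auto)
  \<comment> \<open>Subtracting \<open>h' 0\<close> gives \<open>h 0 = 0\<close> and still
    \<open>g = exp h\<close>, because \<open>exp (h' 0) = g 0 = 1\<close>. Here \<open>h'\<close> is
    a logarithm of \<open>g\<close>, not a derivative.\<close>
  define h where "h = (\<lambda>z. h' z - h' 0)"
  have h: "h holomorphic_on ball 0 R" "h 0 = 0"
    unfolding h_def using h'(1) by (auto intro!: holomorphic_intros)
  have gh: "g z = exp (h z)" if "norm z < R" for z
    using h'(2)[of z] h'(2)[of 0] that R g0 by (simp add: h_def exp_diff)
  have Re_h: "Re (h z) \<le> C * sqrt (2 * R)" if "norm z < R" for z
    using norm_g[of z] gh[OF that] that R by simp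
  define H where "H = fps_expansion h 0"
  have H: "h has_fps_expansion H"
    unfolding H_def using R by (intro has_fps_expansion_fps_expansion[OF _ _ h(1)]) auto
  define G where "G = fps_expansion g 0"
  have G: "g has_fps_expansion G"
    unfolding G_def by (intro has_fps_expansion_fps_expansion[OF _ _ g(1)]) auto
  have "fps_nth G 0 = 1"
    using fps_nth_fps_expansion[OF G, of 0] g0 by simp
  \<comment> \<open>The chain rule near the origin makes \<open>fps_deriv H\<close> the logarithmic
    derivative of \<open>G\<close>.\<close>
  have "deriv g has_fps_expansion fps_deriv H * G"
  proof -
    have "(\<lambda>z. deriv h z * g z) has_fps_expansion fps_deriv H * G"
      by (intro fps_expansion_intros H G)
    also have "?this \<longleftrightarrow> ?thesis"
    proof (rule has_fps_expansion_cong[OF _ refl])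
      have "eventually (\<lambda>z. z \<in> ball 0 R) (nhds (0::complex))"
        using R by (intro eventually_nhds_in_open) auto
      then show "\<forall>\<^sub>F z in nhds 0. deriv h z * g z = deriv g z"
      proof eventually_elim
        case (elim z)
        then have "eventually (\<lambda>w. w \<in> ball 0 R) (nhds z)"
          by (intro eventually_nhds_in_open) auto
        then have "\<forall>\<^sub>F w in nhds z. g w = exp (h w)"
          by eventually_elim (simp add: gh)
        then have "deriv g z = deriv (\<lambda>w. exp (h w)) z"
          by (intro deriv_cong_ev) auto
        also have "(h has_field_derivative deriv h z) (at z)"
          using elim by (intro holomorphic_derivI[OF h(1)]) auto
        then have "deriv (\<lambda>w. exp (h w)) z = exp (h z) * deriv h z"
          by (intro DERIV_imp_deriv DERIV_fun_exp)
        finally show ?case using elim by (simp add: gh)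
      qed
    qed
    finally show ?thesis .
  qed
  then have "fps_deriv G = fps_deriv H * G"
    using fps_expansion_unique_complex has_fps_expansion_deriv[OF G] by blast
  then have logG: "fps_deriv G * inverse G = fps_deriv H"
    using \<open>fps_nth G 0 = 1\<close> by (simp add: mult.assoc inverse_mult_eq_1')
  define P where "P = (\<Prod>a\<in>A. 1 - fps_const (1 / a) * fps_X)"
  have "(\<lambda>z. (\<Prod>a\<in>A. 1 - (1 / a) * z) * g z) has_fps_expansion P * G"
    unfolding P_def by (intro fps_expansion_intros G)
  then have "F = P * G"
    using fps_expansion_unique_complex[OF F, of "P * G"] by (simp add: g(2)[abs_def])
  moreover have "fps_nth P 0 \<noteq> 0"
    unfolding P_def by (induction A rule: infinite_finite_induct) auto
  ultimately have "fps_deriv F * inverse F = fps_deriv P * inverse P + fps_deriv H"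
    using fps_logderiv_mult[of P G] \<open>fps_nth G 0 = 1\<close> logG by simp
  moreover have "fps_deriv P * inverse P = (\<Sum>a\<in>A. fps_deriv (1 - fps_const (1 / a) * fps_X) *
      inverse (1 - fps_const (1 / a) * fps_X))"
    unfolding P_def by (rule fps_logderiv_prod) simp
  ultimately have "fps_nth (fps_deriv F * inverse F) k = (\<Sum>a\<in>A. - 1 / a ^ Suc k) + fps_nth (fps_deriv H) k"
    by (simp only: fps_add_nth fps_sum_nth fps_logderiv_linear)
  also have "(\<Sum>a\<in>A. - 1 / a ^ Suc k) = - (\<Sum>a\<in>A. 1 / a ^ Suc k)"
    by (simp only: sum_negf[symmetric] minus_divide_left)
  finally have "fps_nth (fps_deriv F * inverse F) k + (\<Sum>a\<in>A. 1 / a ^ Suc k) =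
      of_nat (Suc k) * fps_nth H (Suc k)"
    by simp
  moreover have "norm (fps_nth H (Suc k)) \<le> 4 * (C * sqrt (2 * R)) / (R / 2) ^ Suc k"
    using C R Re_h by (intro norm_fps_nth_le_of_Re_le[OF h R _ _ H]) auto
  ultimately show ?thesis
    unfolding A_def[symmetric] by (simp only: norm_mult norm_of_nat mult_left_mono of_nat_0_le_iff)
qed

text \<open>Absolute summability is known, so the value can be computed along the discs of radius
  \<open>n\<close>, where the previous estimate tends to 0.\<close>

theorem has_sum_zeros_power:
  assumes F: "f has_fps_expansion F"
  shows "((\<lambda>z. 1 / z ^ Suc k) has_sum - fps_nth (fps_deriv F * inverse F) k) {z. f z = 0}"
proof -
  let ?Z = "{z. f z = 0}" and ?c = "fps_nth (fps_deriv F * inverse F) k"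
  let ?S = "\<lambda>n. \<Sum>a\<in>?Z \<inter> cball 0 (real n). 1 / a ^ Suc k"
  obtain s where s: "((\<lambda>z. 1 / z ^ Suc k) has_sum s) ?Z"
    using abs_summable_summable[OF abs_summable_zeros[of k]] unfolding summable_on_def by blast
  \<comment> \<open>Every finite set of zeros is bounded, so the discs eventually contain
    it.\<close>
  have "filterlim (\<lambda>n. ?Z \<inter> cball 0 (real n)) (finite_subsets_at_top ?Z) sequentially"
    unfolding filterlim_finite_subsets_at_top
  proof (intro allI impI)
    fix X assume X: "finite X \<and> X \<subseteq> ?Z"
    then obtain B where B: "\<And>x. x \<in> X \<Longrightarrow> norm x \<le> B"
      using finite_imp_bounded[of X] unfolding bounded_iff by blast
    show "\<forall>\<^sub>F n in sequentially. finite (?Z \<inter> cball 0 (real n)) \<and>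
        X \<subseteq> ?Z \<inter> cball 0 (real n) \<and> ?Z \<inter> cball 0 (real n) \<subseteq> ?Z"
      using eventually_ge_at_top[of "nat \<lceil>B\<rceil>"]
    proof eventually_elim
      case (elim n)
      then have "B \<le> real n" by linarith
      then show ?case using X B finite_zeros_cball by fastforce
    qed
  qed
  then have "?S \<longlonglongrightarrow> s"
    using s unfolding has_sum_def by (rule filterlim_compose[rotated])
  moreover have "(\<lambda>n. ?c + ?S n) \<longlonglongrightarrow> 0"
  proof (rule Lim_null_comparison)
    show "\<forall>\<^sub>F n in sequentially. norm (?c + ?S n) \<le>
        real (Suc k) * (4 * (C * sqrt (2 * real n)) / (real n / 2) ^ Suc k)"
      using eventually_gt_at_top[of 0]
      by eventually_elim (intro logderiv_minus_partial_sum_le[OF F], simp)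
    \<comment> \<open>The bound is of order \<open>n\<close> to the power
      \<open>- k - 1 / 2\<close>, which decays even for \<open>k = 0\<close>.\<close>
    show "(\<lambda>n. real (Suc k) * (4 * (C * sqrt (2 * real n)) / (real n / 2) ^ Suc k)) \<longlonglongrightarrow> 0"
    proof -
      have "(\<lambda>n. real (Suc k) * 4 * C * 2 ^ Suc k * (sqrt (2 * real n) / real n ^ Suc k)) \<longlonglongrightarrow> real (Suc k) * 4 * C * 2 ^ Suc k * 0"
        by (intro tendsto_mult tendsto_const) real_asymp
      then show ?thesis
        by (simp add: power_divide field_simps)
    qed
  qed
  ultimately have "(\<lambda>n. (?c + ?S n) - ?S n) \<longlonglongrightarrow> 0 - s"
    by (intro tendsto_diff)
  then have "?c = - s"
    by (simp add: LIMSEQ_const_iff)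
  then show ?thesis using s by simp
qed

end

subsection \<open>The Bessel series\<close>

text \<open>The parameter is \<open>b = \<nu> + 1\<close>, and the variable stands for \<open>z\<^sup>2\<close>.\<close>

definition bessel_fps :: "complex \<Rightarrow> complex fps" where
  "bessel_fps b = Abs_fps (\<lambda>m. (- 1 / 4) ^ m / (fact m * pochhammer b m))"

lemma nonpos_Ints_plus_of_nat: "b \<notin> \<int>\<^sub>\<le>\<^sub>0 \<Longrightarrow> b + of_nat n \<notin> \<int>\<^sub>\<le>\<^sub>0"
  for b :: "'a :: ring_char_0"
  by (metis add_diff_cancel_right' nonpos_Ints_diff_Nats of_nat_in_Nats)

lemma pochhammer_nz: "b \<notin> \<int>\<^sub>\<le>\<^sub>0 \<Longrightarrow> pochhammer b n \<noteq> 0"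
  for b :: "'a :: field_char_0"
  by (auto simp: pochhammer_eq_0_iff)

lemma bessel_fps_nth_0 [simp]: "fps_nth (bessel_fps b) 0 = 1"
  by (simp add: bessel_fps_def)

text \<open>Normalized form of the rule that the derivative of
  \<open>z powr (- \<nu>) * J_\<nu>(z)\<close> is
  \<open>- z powr (- \<nu>) * J_(\<nu>+1)(z)\<close>.\<close>

lemma fps_deriv_bessel_fps: "fps_deriv (bessel_fps b) = fps_const (- 1 / (4 * b)) * bessel_fps (b + 1)"
  by (rule fps_ext) (simp add: bessel_fps_def pochhammer_rec divide_simps del: of_nat_Suc)

text \<open>Normalized form of \<open>J_\<nu>(z) + J_(\<nu>+2)(z) = (2 * (\<nu> + 1) / z) *
  J_(\<nu>+1)(z)\<close>, with \<open>b = \<nu> + 1\<close>.\<close>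

lemma bessel_fps_contiguous:
  assumes b: "b \<notin> \<int>\<^sub>\<le>\<^sub>0"
  shows "bessel_fps b - bessel_fps (b + 1) =
    fps_const (- 1 / (4 * b * (b + 1))) * fps_X * bessel_fps (b + 2)"
proof (rule fps_ext)
  fix n
  show "fps_nth (bessel_fps b - bessel_fps (b + 1)) n =
    fps_nth (fps_const (- 1 / (4 * b * (b + 1))) * fps_X * bessel_fps (b + 2)) n"
  proof (cases n)
    case 0
    then show ?thesis by (simp add: bessel_fps_def)
  next
    case (Suc m)
    let ?P = "pochhammer (b + 1) m" and ?Q = "pochhammer (b + 2) m"
    have b1: "b + 1 \<notin> \<int>\<^sub>\<le>\<^sub>0" "b + 2 \<notin> \<int>\<^sub>\<le>\<^sub>0"
      using nonpos_Ints_plus_of_nat[OF b, of 1] nonpos_Ints_plus_of_nat[OF b, of 2] by simp_all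
    have nz: "b \<noteq> 0" "b + 1 \<noteq> 0" "?P \<noteq> 0" "?Q \<noteq> 0" "b + 1 + of_nat m \<noteq> 0"
      using b b1 nonpos_Ints_plus_of_nat[OF b1(1), of m] by (auto simp: pochhammer_nz)
    \<comment> \<open>Both sides are \<open>pochhammer (b + 1) (Suc m)\<close>. With this common
      denominator the numerator becomes \<open>Suc m\<close>, which cancels into the
      factorial.\<close>
    have PQ: "?P * (b + 1 + of_nat m) = (b + 1) * ?Q"
      using pochhammer_rec[of "b + 1" m] pochhammer_Suc[of "b + 1" m] by (simp add: add.assoc)
    have "1 / (b * p) - 1 / (p * x) = (x - b) / (b * (p * x))" if "p \<noteq> 0" "x \<noteq> 0" for p x
      using that nz(1) by (simp add: field_simps)
    from this[OF nz(3,5)]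
    have "1 / (b * ?P) - 1 / ((b + 1) * ?Q) = of_nat (Suc m) / (b * (?P * (b + 1 + of_nat m)))"
      unfolding PQ by simp
    then have eq: "1 / (b * ?P) - 1 / ((b + 1) * ?Q) = of_nat (Suc m) / (b * ((b + 1) * ?Q))"
      unfolding PQ .
    have "fps_nth (bessel_fps b - bessel_fps (b + 1)) n =
        (- 1 / 4) ^ Suc m / fact (Suc m) * (1 / (b * ?P) - 1 / ((b + 1) * ?Q))"
      by (simp add: Suc bessel_fps_def pochhammer_rec[of _ m] add.assoc right_diff_distrib
          del: fact_Suc power_Suc)
    also have "\<dots> = (- 1 / 4) ^ Suc m * (of_nat (Suc m) / fact (Suc m)) / (b * ((b + 1) * ?Q))"
      unfolding eq by simp
    also have "of_nat (Suc m) / fact (Suc m) = 1 / (fact m :: complex)"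
      by (simp add: divide_simps del: of_nat_Suc)
    also have "(- 1 / 4) ^ Suc m * (1 / (fact m :: complex)) / (b * ((b + 1) * ?Q)) =
        fps_nth (fps_const (- 1 / (4 * b * (b + 1))) * fps_X * bessel_fps (b + 2)) n"
      by (simp add: Suc bessel_fps_def mult.assoc fps_mult_left_const_nth)
    finally show ?thesis .
  qed
qed

section \<open>Growth of the Bessel series and simplicity of its zeros\<close>

lemma norm_plus_of_nat_ge:
  fixes b :: complex
  assumes b: "b \<notin> \<int>\<^sub>\<le>\<^sub>0"
  obtains \<delta> where "0 < \<delta>" "\<And>k. \<delta> * real (Suc k) \<le> norm (b + of_nat k)"
proof -
  \<comment> \<open>For \<open>k > N\<close> the inequality \<open>norm b \<le> (k - 1) / 2\<close>
    makes the ratio at least \<open>1 / 2\<close>; the finitely many others have a positive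
    minimum.\<close>
  define N where "N = nat \<lceil>2 * norm b + 1\<rceil>"
  define \<delta> where "\<delta> = Min (insert (1 / 2) ((\<lambda>k. norm (b + of_nat k) / real (Suc k)) ` {..N}))"
  have nz: "b + of_nat k \<noteq> 0" for k
    using nonpos_Ints_plus_of_nat[OF b, of k] by auto
  show ?thesis
  proof
    show "0 < \<delta>" using nz by (auto simp: \<delta>_def)
    fix k
    show "\<delta> * real (Suc k) \<le> norm (b + of_nat k)"
    proof (cases "k \<le> N")
      case True
      then have "\<delta> \<le> norm (b + of_nat k) / real (Suc k)"
        unfolding \<delta>_def by (intro Min_le) auto
      then show ?thesis by (simp add: field_simps)
    next
      case False
      then have "2 * norm b + 1 \<le> real k"
        unfolding N_def by linarith
      moreover have "\<delta> * real (Suc k) \<le> 1 / 2 * real (Suc k)"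
        unfolding \<delta>_def by (intro mult_right_mono Min_le) auto
      moreover have "real k - norm b \<le> norm (b + of_nat k)"
        by (metis add.commute norm_diff_ineq norm_of_nat)
      ultimately have "1 / 2 * real (Suc k) \<le> norm (b + of_nat k)" by simp
      with \<open>\<delta> * real (Suc k) \<le> 1 / 2 * real (Suc k)\<close> show ?thesis by (rule order.trans)
    qed
  qed
qed

text \<open>The Pochhammer symbol is at least \<open>\<delta> ^ m * fact m\<close>, so the terms are
  at most \<open>(s ^ m / fact m)\<^sup>2\<close> with
  \<open>s = sqrt (norm z / (4 * \<delta>))\<close>. Bounding one factor by \<open>exp s\<close> and
  summing the other gives \<open>exp (2 * s)\<close>.\<close>

lemma bessel_fps_growth:
  assumes b: "b \<notin> \<int>\<^sub>\<le>\<^sub>0"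
  obtains C where "0 < C" "\<And>z. summable (\<lambda>m. fps_nth (bessel_fps b) m * z ^ m)"
    "\<And>z. norm (eval_fps (bessel_fps b) z) \<le> exp (C * sqrt (norm z))"
proof -
  obtain \<delta> where \<delta>: "0 < \<delta>" "\<And>k. \<delta> * real (Suc k) \<le> norm (b + of_nat k)"
    using norm_plus_of_nat_ge[OF b] by blast
  have poch: "\<delta> ^ m * fact m \<le> norm (pochhammer b m)" for m
  proof (induction m)
    case (Suc m)
    have "\<delta> ^ Suc m * fact (Suc m) = \<delta> ^ m * fact m * (\<delta> * real (Suc m))"
      by simp
    also have "\<dots> \<le> norm (pochhammer b m) * norm (b + of_nat m)"
      using Suc \<delta> by (intro mult_mono) auto
    finally show ?case by (simp add: pochhammer_Suc norm_mult)
  qed simp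
  define s where "s = (\<lambda>z :: complex. sqrt (norm z / (4 * \<delta>)))"
  have exps: "(\<lambda>m. s z ^ m / fact m) sums exp (s z)" for z
    using exp_converges[of "s z"] by (simp add: divide_inverse mult.commute)
  have s_nonneg: "0 \<le> s z" for z using \<delta>(1) by (simp add: s_def)
  have bound: "norm (fps_nth (bessel_fps b) m * z ^ m) \<le> exp (s z) * (s z ^ m / fact m)" for m z
  proof -
    have "norm (fps_nth (bessel_fps b) m * z ^ m) = (norm z / 4) ^ m / (fact m * norm (pochhammer b m))"
      by (simp add: bessel_fps_def norm_mult norm_divide norm_power power_divide)
    also have "\<dots> \<le> (norm z / 4) ^ m / (fact m * (\<delta> ^ m * fact m))"
      using poch[of m] \<delta>(1) pochhammer_nz[OF b, of m]
      by (intro divide_left_mono mult_left_mono mult_pos_pos) auto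
    also have "\<dots> = (norm z / (4 * \<delta>)) ^ m / (fact m * fact m)"
      by (simp add: power_divide power_mult_distrib)
    also have "norm z / (4 * \<delta>) = s z * s z"
      using \<delta>(1) by (simp add: s_def)
    also have "(s z * s z) ^ m / (fact m * fact m) = (s z ^ m / fact m) * (s z ^ m / fact m)"
      by (simp add: power_mult_distrib)
    also have "s z ^ m / fact m \<le> exp (s z)"
      using sum_le_suminf[OF sums_summable[OF exps], of "{m}" z] sums_unique[OF exps[of z]] s_nonneg[of z]
      by simp
    then have "(s z ^ m / fact m) * (s z ^ m / fact m) \<le> exp (s z) * (s z ^ m / fact m)"
      using s_nonneg[of z] by (intro mult_right_mono) auto
    finally show ?thesis .
  qed
  have majorant: "(\<lambda>m. exp (s z) * (s z ^ m / fact m)) sums (exp (s z) * exp (s z))" for z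
    by (intro sums_mult exps)
  show ?thesis
  proof
    show "0 < 1 / sqrt \<delta>" using \<delta>(1) by simp
    show "summable (\<lambda>m. fps_nth (bessel_fps b) m * z ^ m)" for z
      by (rule summable_comparison_test'[OF sums_summable[OF majorant[of z]], of 0]) (rule bound)
    have "norm (eval_fps (bessel_fps b) z) \<le> exp (s z) * exp (s z)" for z
      unfolding eval_fps_def sums_unique[OF majorant[of z]]
      by (rule norm_suminf_le[OF bound sums_summable[OF majorant]])
    moreover have "s z + s z = 1 / sqrt \<delta> * sqrt (norm z)" for z
      by (simp add: s_def real_sqrt_divide real_sqrt_mult)
    ultimately show "norm (eval_fps (bessel_fps b) z) \<le> exp (1 / sqrt \<delta> * sqrt (norm z))" for z
      by (simp only: exp_add[symmetric])
  qed
qed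

lemma fps_conv_radius_bessel_fps:
  assumes "b \<notin> \<int>\<^sub>\<le>\<^sub>0"
  shows "fps_conv_radius (bessel_fps b) = \<infinity>"
  unfolding fps_conv_radius_def
  using bessel_fps_growth[OF assms] by (intro conv_radius_inftyI'') metis

lemma deriv_eval_bessel_fps:
  assumes b: "b \<notin> \<int>\<^sub>\<le>\<^sub>0"
  shows "(eval_fps (bessel_fps b) has_field_derivative
    - 1 / (4 * b) * eval_fps (bessel_fps (b + 1)) z) (at z)"
proof -
  have "b + 1 \<notin> \<int>\<^sub>\<le>\<^sub>0" using nonpos_Ints_plus_of_nat[OF b, of 1] by simp
  then have "eval_fps (fps_deriv (bessel_fps b)) z = - 1 / (4 * b) * eval_fps (bessel_fps (b + 1)) z"
    unfolding fps_deriv_bessel_fps by (subst eval_fps_mult) (auto simp: fps_conv_radius_bessel_fps)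
  then show ?thesis
    using has_field_derivative_eval_fps[of z "bessel_fps b" UNIV] by (simp add: fps_conv_radius_bessel_fps b)
qed

lemma eval_bessel_fps_contiguous:
  assumes b: "b \<notin> \<int>\<^sub>\<le>\<^sub>0"
  shows "eval_fps (bessel_fps b) z - eval_fps (bessel_fps (b + 1)) z =
    - 1 / (4 * b * (b + 1)) * z * eval_fps (bessel_fps (b + 2)) z"
proof -
  have b12: "b + 1 \<notin> \<int>\<^sub>\<le>\<^sub>0" "b + 2 \<notin> \<int>\<^sub>\<le>\<^sub>0"
    using nonpos_Ints_plus_of_nat[OF b, of 1] nonpos_Ints_plus_of_nat[OF b, of 2] by simp_all
  have "fps_conv_radius (fps_const c * fps_X) = \<infinity>" for c :: complex
    using fps_conv_radius_mult[of "fps_const c" fps_X] by simp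
  then have "eval_fps (fps_const c * fps_X * bessel_fps (b + 2)) z = c * z * eval_fps (bessel_fps (b + 2)) z" for c
    using b12 by (simp add: eval_fps_mult fps_conv_radius_bessel_fps)
  moreover have "eval_fps (bessel_fps b - bessel_fps (b + 1)) z =
      eval_fps (bessel_fps b) z - eval_fps (bessel_fps (b + 1)) z"
    by (rule eval_fps_diff) (simp_all add: fps_conv_radius_bessel_fps b b12)
  ultimately show ?thesis
    by (simp only: bessel_fps_contiguous[OF b])
qed

text \<open>At a double zero all higher derivatives vanish too, being multiples of
  \<open>eval_fps (bessel_fps (b + n))\<close>, which satisfy a three-term recurrence in \<open>n\<close>.\<close>

lemma eval_bessel_fps_simple_zero:
  assumes b: "b \<notin> \<int>\<^sub>\<le>\<^sub>0" and z: "eval_fps (bessel_fps b) z = 0"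
  shows "deriv (eval_fps (bessel_fps b)) z \<noteq> 0"
proof
  assume "deriv (eval_fps (bessel_fps b)) z = 0"
  moreover have "b \<noteq> 0" using b by auto
  ultimately have z1: "eval_fps (bessel_fps (b + 1)) z = 0"
    using DERIV_imp_deriv[OF deriv_eval_bessel_fps[OF b, of z]] by simp
  have "z \<noteq> 0" using z by (auto simp: eval_fps_at_0)
  have bn: "b + of_nat n \<notin> \<int>\<^sub>\<le>\<^sub>0" for n by (rule nonpos_Ints_plus_of_nat[OF b])
  have "eval_fps (bessel_fps (b + of_nat n)) z = 0 \<and> eval_fps (bessel_fps (b + of_nat n + 1)) z = 0" for n
  proof (induction n)
    case (Suc n)
    have "b + of_nat n + 1 \<notin> \<int>\<^sub>\<le>\<^sub>0" using bn[of "Suc n"] by (simp add: add.assoc add.commute[of 1])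
    then have "b + of_nat n \<noteq> 0" "b + of_nat n + 1 \<noteq> 0" using bn[of n] by auto
    \<comment> \<open>The recurrence carries the factor \<open>z\<close>, so
      \<open>z \<noteq> 0\<close> is what lets the vanishing pass on.\<close>
    then have "eval_fps (bessel_fps (b + of_nat n + 2)) z = 0"
      using eval_bessel_fps_contiguous[OF bn, of n z] Suc \<open>z \<noteq> 0\<close>
      by (simp del: distrib_left_numeral)
    then show ?case using Suc by (simp add: ac_simps)
  qed (simp_all add: z z1)
  moreover have "\<exists>c. \<forall>w. (deriv ^^ n) (eval_fps (bessel_fps b)) w = c * eval_fps (bessel_fps (b + of_nat n)) w" for n
  proof (induction n)
    case 0
    show ?case by (rule exI[of _ 1]) simp
  next
    case (Suc n)
    then obtain c where c: "(deriv ^^ n) (eval_fps (bessel_fps b)) = (\<lambda>w. c * eval_fps (bessel_fps (b + of_nat n)) w)"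
      by auto
    have "(deriv ^^ Suc n) (eval_fps (bessel_fps b)) w =
        c * (- 1 / (4 * (b + of_nat n))) * eval_fps (bessel_fps (b + of_nat (Suc n))) w" for w
      using DERIV_imp_deriv[OF DERIV_cmult[OF deriv_eval_bessel_fps[OF bn[of n], of w], of c]]
      by (simp add: c ac_simps)
    then show ?case by blast
  qed
  ultimately have "(deriv ^^ n) (eval_fps (bessel_fps b)) z = 0" for n
    by (metis mult_zero_right)
  then have "eval_fps (bessel_fps b) 0 = 0"
    by (intro holomorphic_fun_eq_0_on_connected[of "eval_fps (bessel_fps b)" UNIV z])
      (auto intro!: holomorphic_intros simp: fps_conv_radius_bessel_fps b)
  then show False by (simp add: eval_fps_at_0)
qed

section \<open>Rayleigh functions as power series coefficients\<close>

text \<open>Generating function of the Rayleigh functions for \<open>\<nu> = b - 1\<close>, shifted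
  by one: coefficient \<open>k\<close> is the sum of order \<open>2 * (k + 1)\<close>.\<close>

definition rayleigh_fps :: "complex \<Rightarrow> complex fps" where
  "rayleigh_fps b = - (fps_deriv (bessel_fps b) * inverse (bessel_fps b))"

lemma has_sum_bessel_fps_zeros:
  assumes b: "b \<notin> \<int>\<^sub>\<le>\<^sub>0"
  shows "((\<lambda>z. 1 / z ^ Suc k) has_sum fps_nth (rayleigh_fps b) k) {z. eval_fps (bessel_fps b) z = 0}"
proof -
  obtain C where C: "0 < C" "\<And>z. norm (eval_fps (bessel_fps b) z) \<le> exp (C * sqrt (norm z))"
    using bessel_fps_growth[OF b] by metis
  interpret entire_sqrt_growth "eval_fps (bessel_fps b)" C
    using C eval_bessel_fps_simple_zero[OF b]
    by unfold_locales (auto intro!: holomorphic_intros simp: fps_conv_radius_bessel_fps b eval_fps_at_0)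
  show ?thesis
    using has_sum_zeros_power[of "bessel_fps b" k] eval_fps_has_fps_expansion[of "bessel_fps b"]
    by (simp add: fps_conv_radius_bessel_fps b rayleigh_fps_def)
qed

lemma Bessel_J_eval_fps:
  assumes \<nu>: "\<nu> + 1 \<notin> \<int>\<^sub>\<le>\<^sub>0" and "z \<noteq> 0"
  shows "z powr (- \<nu>) * Bessel_J \<nu> z = 2 powr (- \<nu>) * rGamma (\<nu> + 1) * eval_fps (bessel_fps (\<nu> + 1)) (z\<^sup>2)"
proof -
  have "(- 1) ^ m * rGamma (\<nu> + of_nat m + 1) / fact m * (z / 2) ^ (2 * m) =
      rGamma (\<nu> + 1) * (fps_nth (bessel_fps (\<nu> + 1)) m * (z\<^sup>2) ^ m)" for m
  proof -
    have "rGamma (\<nu> + 1) = pochhammer (\<nu> + 1) m * rGamma (\<nu> + of_nat m + 1)"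
      using pochhammer_rGamma[of "\<nu> + 1" m] by (simp add: ac_simps)
    moreover have "(z / 2) ^ (2 * m) = (z\<^sup>2) ^ m / 4 ^ m"
      by (simp add: power_mult power_divide)
    moreover have "(- 1 / 4) ^ m = (- 1) ^ m / (4 :: complex) ^ m"
      by (simp only: power_divide)
    ultimately show ?thesis
      using pochhammer_nz[OF \<nu>, of m] by (simp add: bessel_fps_def ac_simps)
  qed
  moreover have "summable (\<lambda>m. fps_nth (bessel_fps (\<nu> + 1)) m * (z\<^sup>2) ^ m)"
    by (rule summable_fps) (simp add: fps_conv_radius_bessel_fps \<nu>)
  ultimately show ?thesis
    unfolding Bessel_J_normalized[OF \<open>z \<noteq> 0\<close>] by (simp add: suminf_mult eval_fps_def)
qed

text \<open>The half-plane condition selects one of each pair \<open>z\<close>, \<open>- z\<close>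
  and agrees with the range of \<open>csqrt\<close> away from 0, so \<open>csqrt\<close> inverts the
  squaring.\<close>

lemma bij_betw_Bessel_zeros:
  assumes \<nu>: "\<nu> + 1 \<notin> \<int>\<^sub>\<le>\<^sub>0"
  shows "bij_betw (\<lambda>z. z\<^sup>2) (Bessel_zeros \<nu>) {w. eval_fps (bessel_fps (\<nu> + 1)) w = 0}"
proof (rule bij_betw_imageI)
  have iff: "z powr (- \<nu>) * Bessel_J \<nu> z = 0 \<longleftrightarrow> eval_fps (bessel_fps (\<nu> + 1)) (z\<^sup>2) = 0" if "z \<noteq> 0" for z
    using \<nu> by (simp add: Bessel_J_eval_fps[OF \<nu> that] rGamma_eq_zero_iff)
  show "inj_on (\<lambda>z. z\<^sup>2) (Bessel_zeros \<nu>)"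
    by (rule inj_onI) (auto simp: Bessel_zeros_def power2_eq_iff)
  show "(\<lambda>z. z\<^sup>2) ` Bessel_zeros \<nu> = {w. eval_fps (bessel_fps (\<nu> + 1)) w = 0}"
  proof (intro equalityI subsetI)
    fix w assume "w \<in> (\<lambda>z. z\<^sup>2) ` Bessel_zeros \<nu>"
    then obtain z where z: "w = z\<^sup>2" "z \<in> Bessel_zeros \<nu>" by blast
    then have "z \<noteq> 0" by (auto simp: Bessel_zeros_def)
    then show "w \<in> {w. eval_fps (bessel_fps (\<nu> + 1)) w = 0}"
      using z iff[of z] by (simp add: Bessel_zeros_def)
  next
    fix w assume w: "w \<in> {w. eval_fps (bessel_fps (\<nu> + 1)) w = 0}"
    then have "w \<noteq> 0" by (auto simp: eval_fps_at_0)
    then have "csqrt w \<noteq> 0" by simp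
    then have "0 < Re (csqrt w) \<or> Re (csqrt w) = 0 \<and> 0 < Im (csqrt w)"
      using csqrt_principal[of w] by (auto simp: complex_eq_iff less_le)
    then have "csqrt w \<in> Bessel_zeros \<nu>"
      using w iff[OF \<open>csqrt w \<noteq> 0\<close>] by (simp add: Bessel_zeros_def)
    then show "w \<in> (\<lambda>z. z\<^sup>2) ` Bessel_zeros \<nu>"
      by (rule rev_image_eqI) simp
  qed
qed

lemma Rayleigh_eq_fps_nth:
  assumes \<nu>: "\<nu> + 1 \<notin> \<int>\<^sub>\<le>\<^sub>0"
  shows "Rayleigh (Suc k) \<nu> = fps_nth (rayleigh_fps (\<nu> + 1)) k"
proof -
  have "Rayleigh (Suc k) \<nu> = (\<Sum>\<^sub>\<infinity>z\<in>Bessel_zeros \<nu>. 1 / (z\<^sup>2) ^ Suc k)"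
    by (simp only: Rayleigh_def power_mult)
  also have "\<dots> = (\<Sum>\<^sub>\<infinity>w\<in>{w. eval_fps (bessel_fps (\<nu> + 1)) w = 0}. 1 / w ^ Suc k)"
    by (rule infsum_reindex_bij_betw[OF bij_betw_Bessel_zeros[OF \<nu>]])
  also have "\<dots> = fps_nth (rayleigh_fps (\<nu> + 1)) k"
    by (rule infsumI[OF has_sum_bessel_fps_zeros[OF \<nu>]])
  finally show ?thesis .
qed

section \<open>The Riccati equation and the determinant recursion\<close>

text \<open>By the derivative rule each series is a multiple of a quotient of consecutive
  \<open>F i\<close>. Their product telescopes to \<open>F 2 / F 0\<close>, and the contiguous
  relation turns \<open>fps_X * F 2\<close> into a multiple of \<open>F 0 - F 1\<close>.\<close>

lemma rayleigh_fps_riccati: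
  assumes b: "b \<notin> \<int>\<^sub>\<le>\<^sub>0"
  shows "rayleigh_fps b = fps_const (1 / (4 * b)) +
    fps_const (1 / b) * fps_X * (rayleigh_fps (b + 1) * rayleigh_fps b)"
proof -
  define F where "F = (\<lambda>i. bessel_fps (b + of_nat i))"
  have inv: "F i * inverse (F i) = 1" for i
    by (simp add: F_def inverse_mult_eq_1')
  have nz: "b \<noteq> 0" "b + 1 \<noteq> 0"
    using b nonpos_Ints_plus_of_nat[OF b, of 1] by auto
  have S0: "rayleigh_fps b = fps_const (1 / (4 * b)) * (F 1 * inverse (F 0))"
    and S1: "rayleigh_fps (b + 1) = fps_const (1 / (4 * (b + 1))) * (F 2 * inverse (F 1))"
    by (simp_all add: rayleigh_fps_def F_def fps_deriv_bessel_fps add.assoc mult.assoc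
        flip: fps_const_neg)
  have "fps_const (1 / b) * fps_X * (rayleigh_fps (b + 1) * rayleigh_fps b) =
      fps_const (1 / b) * fps_const (1 / (4 * (b + 1))) * fps_const (1 / (4 * b)) * fps_X * F 2 *
        inverse (F 0) * (F 1 * inverse (F 1))"
    unfolding S0 S1 by (simp only: ac_simps)
  also have "fps_const (1 / b) * fps_const (1 / (4 * (b + 1))) = - fps_const (- 1 / (4 * b * (b + 1)))"
    by (simp add: field_simps)
  also have "- fps_const (- 1 / (4 * b * (b + 1))) * fps_const (1 / (4 * b)) * fps_X * F 2 *
        inverse (F 0) * (F 1 * inverse (F 1)) =
      - (fps_const (- 1 / (4 * b * (b + 1))) * fps_X * F 2) * (inverse (F 0) * fps_const (1 / (4 * b)))"
    unfolding inv mult_1_right mult_minus_left by (simp only: ac_simps)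
  also have "fps_const (- 1 / (4 * b * (b + 1))) * fps_X * F 2 = F 0 - F 1"
    using bessel_fps_contiguous[OF b] by (simp add: F_def)
  also have "- (F 0 - F 1) * (inverse (F 0) * fps_const (1 / (4 * b))) =
      rayleigh_fps b - fps_const (1 / (4 * b)) * (F 0 * inverse (F 0))"
    unfolding S0 by (simp add: algebra_simps)
  finally show ?thesis by (simp add: inv)
qed

text \<open>The hypotheses of the two Hankel lemmas, with \<open>c = 1 / (4 * b)\<close> and
  \<open>d = 1 / b\<close>.\<close>

lemma rayleigh_fps_nth:
  assumes b: "b \<notin> \<int>\<^sub>\<le>\<^sub>0"
  shows "fps_nth (rayleigh_fps b) 0 = 1 / (4 * b)"
    and "fps_nth (rayleigh_fps b) (Suc m) =
      1 / b * (\<Sum>p\<le>m. fps_nth (rayleigh_fps b) (m - p) * fps_nth (rayleigh_fps (b + 1)) p)"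
proof -
  let ?R = "fps_const (1 / (4 * b)) + fps_const (1 / b) * fps_X * (rayleigh_fps (b + 1) * rayleigh_fps b)"
  have nth: "fps_nth (rayleigh_fps b) k = fps_nth ?R k" for k
    by (rule arg_cong[OF rayleigh_fps_riccati[OF b], of "\<lambda>F. fps_nth F k"])
  show "fps_nth (rayleigh_fps b) 0 = 1 / (4 * b)"
    unfolding nth by (simp add: mult.assoc)
  have "fps_nth (rayleigh_fps b) (Suc m) = 1 / b * fps_nth (rayleigh_fps (b + 1) * rayleigh_fps b) m"
    unfolding nth by (simp add: mult.assoc fps_mult_left_const_nth)
  also have "fps_nth (rayleigh_fps (b + 1) * rayleigh_fps b) m =
      (\<Sum>p\<le>m. fps_nth (rayleigh_fps b) (m - p) * fps_nth (rayleigh_fps (b + 1)) p)"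
    unfolding fps_mult_nth atLeast0AtMost by (intro sum.cong refl mult.commute)
  finally show "fps_nth (rayleigh_fps b) (Suc m) =
      1 / b * (\<Sum>p\<le>m. fps_nth (rayleigh_fps b) (m - p) * fps_nth (rayleigh_fps (b + 1)) p)" .
qed

text \<open>With \<open>N = 2 * n + l\<close> both Hankel families form one sequence. Each step
  raises \<open>b\<close> and lowers \<open>N\<close> by one, using \<open>det_hankel_odd\<close>
  and \<open>det_hankel_even\<close> in turn.\<close>

lemma det_hankel_rayleigh_fps:
  assumes "b \<notin> \<int>\<^sub>\<le>\<^sub>0"
  shows "Determinant.det (hankel (fps_nth (rayleigh_fps b)) (N mod 2) (N div 2)) =
    (1 / 4) ^ (N div 2 * (N div 2 + N mod 2)) * (\<Prod>k<N. (1 / (b + of_nat k)) ^ (N - 1 - k))"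
  using assms
proof (induction N arbitrary: b)
  case 0
  then show ?case by (simp add: hankel_def)
next
  case (Suc N)
  let ?D = "\<lambda>b N. Determinant.det (hankel (fps_nth (rayleigh_fps b)) (N mod 2) (N div 2))"
  have b1: "b + 1 \<notin> \<int>\<^sub>\<le>\<^sub>0" using nonpos_Ints_plus_of_nat[OF Suc.prems, of 1] by simp
  have "b \<noteq> 0" using Suc.prems by auto
  note rec = rayleigh_fps_nth(2)[OF Suc.prems] rayleigh_fps_nth(1)[OF Suc.prems]
  have "?D b (Suc N) = (1 / 4) ^ (Suc N div 2) * (1 / b) ^ N * ?D (b + 1) N"
  proof (cases "even N")
    case True
    then obtain n where "N = 2 * n" by blast
    moreover have "(1 / (4 * b) * (1 / b)) ^ n = (1 / 4) ^ n * (1 / b) ^ (2 * n)"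
      by (simp add: power_mult_distrib power_divide mult_2 power_add)
    ultimately show ?thesis
      using det_hankel_odd[OF rec, of n] \<open>b \<noteq> 0\<close> by simp
  next
    case False
    then obtain n where "N = 2 * n + 1" by (blast elim: oddE)
    moreover have "(1 / (4 * b)) ^ Suc n * (1 / b) ^ n = (1 / 4) ^ Suc n * (1 / b) ^ (2 * n + 1)"
      by (simp add: power_mult_distrib power_divide mult_2 power_add)
    ultimately show ?thesis
      using det_hankel_even[OF rec, of n] \<open>b \<noteq> 0\<close> by simp
  qed
  also have "?D (b + 1) N = (1 / 4) ^ (N div 2 * (N div 2 + N mod 2)) *
      (\<Prod>k<N. (1 / (b + 1 + of_nat k)) ^ (N - 1 - k))"
    by (rule Suc.IH[OF b1])
  also have "(1 / 4) ^ (Suc N div 2) * (1 / b) ^ N * \<dots> =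
      (1 / 4) ^ (Suc N div 2 + N div 2 * (N div 2 + N mod 2)) *
      ((1 / b) ^ N * (\<Prod>k<N. (1 / (b + 1 + of_nat k)) ^ (N - 1 - k)))"
    by (simp only: power_add ac_simps)
  \<comment> \<open>The two cases are \<open>n + n * n = n * (n + 1)\<close> and
    \<open>(n + 1) + n * (n + 1) = (n + 1) * (n + 1)\<close>.\<close>
  also have "Suc N div 2 + N div 2 * (N div 2 + N mod 2) = Suc N div 2 * (Suc N div 2 + Suc N mod 2)"
  proof (cases "even N")
    case True
    then obtain n where n: "N = 2 * n" by blast
    then have "Suc N div 2 = n" "Suc N mod 2 = 1" by presburger+
    with n show ?thesis by (simp add: algebra_simps)
  next
    case False
    then obtain n where n: "N = 2 * n + 1" by (blast elim: oddE)
    then have "N div 2 = n" "N mod 2 = 1" "Suc N div 2 = Suc n" "Suc N mod 2 = 0" by presburger+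
    then show ?thesis by (simp add: algebra_simps)
  qed
  also have "(1 / b) ^ N * (\<Prod>k<N. (1 / (b + 1 + of_nat k)) ^ (N - 1 - k)) =
      (\<Prod>k<Suc N. (1 / (b + of_nat k)) ^ (Suc N - 1 - k))"
    by (subst prod.lessThan_Suc_shift) (simp add: add.assoc)
  finally show ?case .
qed

theorem corollary3:
  fixes n l :: nat and \<nu> :: complex
  assumes "n \<ge> 1"
    and "\<And>k :: nat. k \<ge> 1 \<Longrightarrow> \<nu> \<noteq> - of_nat k"
    and "l \<in> {0, 1}"
  shows "Determinant.det (Rayleigh_Hankel l n \<nu>) =
    2 powi (- (2 * int n * (int n + int l))) *
    (\<Prod>k = 1..2 * n + l - 1. (\<nu> + of_nat k) powi (int k - 2 * int n - int l))"
proof -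
  have \<nu>: "\<nu> + 1 \<notin> \<int>\<^sub>\<le>\<^sub>0"
  proof
    assume "\<nu> + 1 \<in> \<int>\<^sub>\<le>\<^sub>0"
    then obtain k :: nat where "\<nu> + 1 = - of_nat k" by (elim nonpos_Ints_cases')
    then have "\<nu> = - of_nat (Suc k)" by (simp add: algebra_simps eq_neg_iff_add_eq_0)
    then show False using assms(2)[of "Suc k"] by simp
  qed
  define N where "N = 2 * n + l"
  have N: "N div 2 = n" "N mod 2 = l" and "N \<ge> 1"
    using assms(1,3) by (auto simp: N_def)
  \<comment> \<open>The shifts cancel: \<open>Suc i + Suc j + l - 1 = Suc (i + j + l)\<close>, and
    \<open>Rayleigh (Suc k)\<close> is coefficient \<open>k\<close>.\<close>
  have "Rayleigh_Hankel l n \<nu> = hankel (fps_nth (rayleigh_fps (\<nu> + 1))) l n"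
    by (simp add: Rayleigh_Hankel_def hankel_def Rayleigh_eq_fps_nth[OF \<nu>])
  then have "Determinant.det (Rayleigh_Hankel l n \<nu>) =
      (1 / 4) ^ (n * (n + l)) * (\<Prod>k<N. (1 / (\<nu> + 1 + of_nat k)) ^ (N - 1 - k))"
    using det_hankel_rayleigh_fps[OF \<nu>, of N] by (simp only: N)
  also have "(1 / 4) ^ (n * (n + l)) = (2 :: complex) powi (- (2 * int n * (int n + int l)))"
  proof -
    have "2 * int n * (int n + int l) = int (2 * (n * (n + l)))" by simp
    then show ?thesis
      by (simp only: power_int_minus power_int_of_nat power_mult) (simp add: power_divide inverse_eq_divide)
  qed
  \<comment> \<open>The factor at \<open>k = N - 1\<close> has exponent 0.\<close>
  also have "(\<Prod>k<N. (1 / (\<nu> + 1 + of_nat k)) ^ (N - 1 - k)) =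
      (\<Prod>k<N - 1. (1 / (\<nu> + 1 + of_nat k)) ^ (N - 1 - k))"
    using \<open>N \<ge> 1\<close> by (cases N) simp_all
  also have "\<dots> = (\<Prod>k = 1..N - 1. (\<nu> + of_nat k) powi (int k - 2 * int n - int l))"
  proof (rule prod.reindex_bij_witness[of _ "\<lambda>k. k - 1" Suc])
    fix k assume k: "k \<in> {..<N - 1}"
    then have "int (Suc k) - 2 * int n - int l = - int (N - 1 - k)"
      by (auto simp: N_def)
    then show "(\<nu> + of_nat (Suc k)) powi (int (Suc k) - 2 * int n - int l) =
        (1 / (\<nu> + 1 + of_nat k)) ^ (N - 1 - k)"
      by (simp only: power_int_minus power_int_of_nat) (simp add: ac_simps power_divide inverse_eq_divide)
  qed auto
  finally show ?thesis by (simp add: N_def)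
qed

end
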